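(* Let $G$ be a simple, finite, connected graph with vertex set $V=\{v_1,\dots,v_n\}$ and let $M_G$ be a mixed graph with underlying graph $G$ such that every mixed cycle of $M_G$ belongs to the class $\Psi_4$. Then all cofactors of the Hermitian quasi-Laplacian matrix of the second kind $Q(M_G)$ have the same absolute value, and this common absolute value equals the number of spanning trees of $G$.
   Context: A mixed graph $M_G$ is obtained from a simple graph $G$ (its underlying graph) by giving directions to some of the edges of $G$; an edge directed from $v_i$ to $v_j$ is written $v_i\to v_j$, an undirected edge $v_i\leftrightarrow v_j$. Let $\omega=\frac{1+\sqrt{3}\mathbf{i}}{2}$. The Hermitian adjacency matrix of the second kind is the $n\times n$ matrix $N(M_G)=(n_{ij})$ with $n_{ij}=1$ if $v_i\leftrightarrow v_j$, $n_{ij}=\omega$ if $v_i\to v_j$, $n_{ij}=\overline{\omega}$ if $v_j\to v_i$, and $n_{ij}=0$ otherwise. With $D(M_G)$ the diagonal matrix of vertex degrees of $G$, the Hermitian quasi-Laplacian matrix of the second kind is $Q(M_G)=D(M_G)+N(M_G)$. The $(i,j)$ cofactor is $(-1)^{i+j}\det$ of the submatrix obtained by deleting row $i$ and column $j$. A mixed cycle of $M_G$ is the mixed subgraph on a cycle of $G$ (edges keeping their status in $M_G$). For a mixed cycle, fix one of its two cyclic traversal directions and let $a$ be the number of directed edges oriented along the traversal, $b$ the number of directed edges oriented against it, and $c$ the number of undirected edges. The cycle belongs to $\Psi_4$ if $a-b\equiv 0$ or $3 \pmod 6$ and $c$ is even (this does not depend on the chosen traversal direction). *)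

theory Defs
  imports "Jordan_Normal_Form.Determinant" Complex_Main
begin

text \<open>A simple graph is given by a vertex set \<open>V\<close> and a set \<open>E\<close> of two-element subsets of \<open>V\<close>.\<close>

definition simple_graph :: "'a set \<Rightarrow> 'a set set \<Rightarrow> bool" where
  "simple_graph V E \<longleftrightarrow> (\<forall>e\<in>E. e \<subseteq> V \<and> card e = 2)"

definition connected_graph :: "'a set \<Rightarrow> 'a set set \<Rightarrow> bool" where
  "connected_graph V E \<longleftrightarrow>
     V \<noteq> {} \<and> (\<forall>u\<in>V. \<forall>v\<in>V. (u, v) \<in> {(x, y). {x, y} \<in> E}\<^sup>*)"

definition degree_graph :: "'a set set \<Rightarrow> 'a \<Rightarrow> nat" where
  "degree_graph E v = card {e \<in> E. v \<in> e}"

text \<open>A cycle is represented by the list of its vertices in the order of a traversal, without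
  repeating the starting vertex; so every cycle of the graph is represented by several lists, one
  for each starting vertex and traversal direction.\<close>

definition next_vertex :: "'a list \<Rightarrow> nat \<Rightarrow> 'a" where
  "next_vertex p k = p ! (Suc k mod length p)"

definition graph_cycle :: "'a set set \<Rightarrow> 'a list \<Rightarrow> bool" where
  "graph_cycle E p \<longleftrightarrow>
     3 \<le> length p \<and> distinct p \<and> (\<forall>k<length p. {p ! k, next_vertex p k} \<in> E)"

definition tree_graph :: "'a set \<Rightarrow> 'a set set \<Rightarrow> bool" where
  "tree_graph V T \<longleftrightarrow> simple_graph V T \<and> connected_graph V T \<and> (\<nexists>p. graph_cycle T p)"

text \<open>A spanning subgraph is determined by its edge set.\<close>

definition spanning_trees :: "'a set \<Rightarrow> 'a set set \<Rightarrow> 'a set set set" where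
  "spanning_trees V E = {T. T \<subseteq> E \<and> tree_graph V T}"

text \<open>A mixed graph is a simple graph \<open>(V, E)\<close> together with a set \<open>A\<close> of arcs, where
  \<open>(u, v) \<in> A\<close> means that the edge \<open>{u, v}\<close> has been directed from \<open>u\<close> to \<open>v\<close>. The edges with
  neither orientation in \<open>A\<close> are the undirected ones.\<close>

definition mixed_graph :: "'a set \<Rightarrow> 'a set set \<Rightarrow> ('a \<times> 'a) set \<Rightarrow> bool" where
  "mixed_graph V E A \<longleftrightarrow>
     simple_graph V E \<and> (\<forall>(u, v)\<in>A. {u, v} \<in> E \<and> (v, u) \<notin> A)"

definition undirected_edge :: "'a set set \<Rightarrow> ('a \<times> 'a) set \<Rightarrow> 'a \<Rightarrow> 'a \<Rightarrow> bool" where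
  "undirected_edge E A u v \<longleftrightarrow> {u, v} \<in> E \<and> (u, v) \<notin> A \<and> (v, u) \<notin> A"

definition cycle_forward :: "('a \<times> 'a) set \<Rightarrow> 'a list \<Rightarrow> nat" where
  "cycle_forward A p = card {k. k < length p \<and> (p ! k, next_vertex p k) \<in> A}"

definition cycle_backward :: "('a \<times> 'a) set \<Rightarrow> 'a list \<Rightarrow> nat" where
  "cycle_backward A p = card {k. k < length p \<and> (next_vertex p k, p ! k) \<in> A}"

definition cycle_undirected :: "'a set set \<Rightarrow> ('a \<times> 'a) set \<Rightarrow> 'a list \<Rightarrow> nat" where
  "cycle_undirected E A p =
     card {k. k < length p \<and> undirected_edge E A (p ! k) (next_vertex p k)}"

definition in_Psi4 :: "'a set set \<Rightarrow> ('a \<times> 'a) set \<Rightarrow> 'a list \<Rightarrow> bool" where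
  "in_Psi4 E A p \<longleftrightarrow>
     (int (cycle_forward A p) - int (cycle_backward A p)) mod 6 \<in> {0, 3} \<and>
     even (cycle_undirected E A p)"

definition omega :: complex where
  "omega = (1 + complex_of_real (sqrt 3) * \<i>) / 2"

text \<open>For the matrices the vertex set is \<open>{0..<n}\<close>; the vertex \<open>i\<close> stands for the
  \<open>(i + 1)\<close>-st vertex of the usual one-based enumeration.\<close>

definition herm_adj2 :: "nat \<Rightarrow> nat set set \<Rightarrow> (nat \<times> nat) set \<Rightarrow> complex mat" where
  "herm_adj2 n E A = mat n n (\<lambda>(i, j).
     if undirected_edge E A i j then 1
     else if (i, j) \<in> A then omega
     else if (j, i) \<in> A then cnj omega
     else 0)"

definition degree_mat :: "nat \<Rightarrow> nat set set \<Rightarrow> complex mat" where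
  "degree_mat n E = mat n n (\<lambda>(i, j). if i = j then of_nat (degree_graph E i) else 0)"

definition herm_quasi_laplacian2 :: "nat \<Rightarrow> nat set set \<Rightarrow> (nat \<times> nat) set \<Rightarrow> complex mat" where
  "herm_quasi_laplacian2 n E A = degree_mat n E + herm_adj2 n E A"

end

theory Submission
  imports Defs
begin

text \<open>
  Membership in \<open>\<Psi>\<^sub>4\<close> says exactly that the entries of \<open>-N(M\<^sub>G)\<close> multiply to \<open>1\<close> around every cycle
  of \<open>G\<close>. Propagating along a spanning tree and closing up fundamental cycles, one obtains a
  potential \<open>s\<close> with unimodular values and \<open>s\<^sub>u = -N\<^sub>u\<^sub>v s\<^sub>v\<close> on all edges, so that \<open>Q s = 0\<close>. A kernel
  vector makes every row of the cofactor matrix proportional to \<open>s\<close>; hence all cofactors in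
  row \<open>i\<close> have the absolute value of the \<open>(i, i)\<close> one.

  For the \<open>(r, r)\<close> cofactor, replace row \<open>r\<close> by the unit vector and write every other row \<open>i\<close> as the
  sum of \<open>e\<^sub>i + N\<^sub>i\<^sub>j e\<^sub>j\<close> over the neighbours \<open>j\<close> of \<open>i\<close>. Multilinearity expands the determinant over the
  functions \<open>f\<close> choosing a neighbour of each vertex other than \<open>r\<close>. If iterating \<open>f\<close> leads every vertex to \<open>r\<close>,
  the summand is unitriangular and contributes \<open>1\<close>; otherwise it is singular.
  The contributing \<open>f\<close> are the parent maps of the spanning trees rooted at \<open>r\<close>.
\<close>

section \<open>Rooted spanning trees as parent maps\<close>

text \<open>A spanning tree rooted at \<open>r\<close>, each vertex pointing one step towards the
  root. Fixing \<open>r\<close> and all points outside \<open>V\<close> makes \<open>f\<close>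
  unique for its tree and matches the functions over which \<open>det_linear_rows_sum\<close>
  expands a determinant.\<close>

definition parent_map :: "'a set \<Rightarrow> 'a set set \<Rightarrow> 'a \<Rightarrow> ('a \<Rightarrow> 'a) \<Rightarrow> bool" where
  "parent_map V E r f \<longleftrightarrow>
     f r = r \<and> (\<forall>i\<in>V - {r}. {i, f i} \<in> E) \<and> (\<forall>i\<in>V. \<exists>k. (f ^^ k) i = r) \<and> (\<forall>i. i \<notin> V \<longrightarrow> f i = i)"

text \<open>The induction measure for parent maps. It is meaningful only where the orbit of
  \<open>i\<close> reaches \<open>r\<close>; otherwise \<open>LEAST\<close> is unspecified.\<close>

definition depth :: "('a \<Rightarrow> 'a) \<Rightarrow> 'a \<Rightarrow> 'a \<Rightarrow> nat" where
  "depth f r i = (LEAST k. (f ^^ k) i = r)"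

definition parent_edges :: "'a set \<Rightarrow> 'a \<Rightarrow> ('a \<Rightarrow> 'a) \<Rightarrow> 'a set set" where
  "parent_edges V r f = (\<lambda>i. {i, f i}) ` (V - {r})"

lemma simple_graph_edgeD:
  assumes "simple_graph V E" "{u, v} \<in> E"
  shows "u \<in> V" "v \<in> V" "u \<noteq> v"
  using assms by (auto simp: simple_graph_def dest!: bspec)

lemma simple_graph_subset: "simple_graph V E \<Longrightarrow> T \<subseteq> E \<Longrightarrow> simple_graph V T"
  by (auto simp: simple_graph_def)

lemma depth_root: "depth f r r = 0"
  unfolding depth_def by (rule Least_eq_0) simp

lemma depth_step:
  assumes "(f ^^ k) i = r" "i \<noteq> r"
  shows "depth f r i = Suc (depth f r (f i))"
  using Least_Suc[of "\<lambda>k. (f ^^ k) i = r" k] assms by (simp add: depth_def funpow_swap1)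

lemma depth_parent:
  assumes "parent_map V E r f" "i \<in> V" "i \<noteq> r"
  shows "depth f r i = Suc (depth f r (f i))"
  using assms depth_step unfolding parent_map_def by metis

lemma parent_map_closed:
  assumes "parent_map V E r f" "simple_graph V E" "i \<in> V"
  shows "f i \<in> V"
  using assms by (cases "i = r") (auto simp: parent_map_def dest: simple_graph_edgeD)

lemma parent_map_mono: "parent_map V T r f \<Longrightarrow> T \<subseteq> E \<Longrightarrow> parent_map V E r f"
  by (auto simp: parent_map_def)

lemma parent_edges_subset: "parent_map V E r f \<Longrightarrow> parent_edges V r f \<subseteq> E"
  by (auto simp: parent_map_def parent_edges_def)

lemma parent_edges_cases:
  assumes "{x, y} \<in> parent_edges V r f"
  obtains "x \<in> V" "x \<noteq> r" "y = f x" | "y \<in> V" "y \<noteq> r" "x = f y"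
proof -
  from assms obtain i where "i \<in> V" "i \<noteq> r" "{x, y} = {i, f i}" by (auto simp: parent_edges_def)
  then show ?thesis using that by (metis doubleton_eq_iff)
qed

lemma sym_adjacent: "sym {(x, y). {x, y} \<in> T}"
  by (auto simp: sym_def insert_commute)

lemma parent_edges_reach_root:
  assumes "parent_map V E r f" "simple_graph V E" "i \<in> V"
  shows "(i, r) \<in> {(x, y). {x, y} \<in> parent_edges V r f}\<^sup>*"
  using assms(3)
proof (induction "depth f r i" arbitrary: i rule: less_induct)
  case less
  show ?case
  proof (cases "i = r")
    case False
    have "(f i, r) \<in> {(x, y). {x, y} \<in> parent_edges V r f}\<^sup>*"
      using less parent_map_closed[OF assms(1,2)] depth_parent[OF assms(1)] False by simp
    moreover have "{i, f i} \<in> parent_edges V r f"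
      using less.prems False by (auto simp: parent_edges_def)
    ultimately show ?thesis by (auto intro: converse_rtrancl_into_rtrancl)
  qed simp
qed

lemma parent_edges_connected:
  assumes "parent_map V E r f" "simple_graph V E" "r \<in> V"
  shows "connected_graph V (parent_edges V r f)"
  unfolding connected_graph_def
proof (intro conjI ballI)
  fix u v assume "u \<in> V" "v \<in> V"
  note R = parent_edges_reach_root[OF assms(1,2)]
  have "(r, v) \<in> {(x, y). {x, y} \<in> parent_edges V r f}\<^sup>*"
    by (rule symD[OF sym_rtrancl[OF sym_adjacent] R[OF \<open>v \<in> V\<close>]])
  with R[OF \<open>u \<in> V\<close>] show "(u, v) \<in> {(x, y). {x, y} \<in> parent_edges V r f}\<^sup>*"
    by (rule rtrancl_trans)
qed (use assms in auto)

text \<open>At a vertex of maximal depth on a cycle neither cycle neighbour can be a child, so both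
  equal its parent. A cycle of length at least 3 has two distinct neighbours there.\<close>

lemma parent_edges_acyclic:
  assumes f: "parent_map V E r f"
  shows "\<not> graph_cycle (parent_edges V r f) p"
proof
  assume c: "graph_cycle (parent_edges V r f) p"
  let ?n = "length p"
  have n3: "3 \<le> ?n" and dp: "distinct p"
    and e: "\<And>k. k < ?n \<Longrightarrow> {p ! k, p ! (Suc k mod ?n)} \<in> parent_edges V r f"
    using c by (auto simp: graph_cycle_def next_vertex_def)
  define m where "m = Max ((\<lambda>k. depth f r (p ! k)) ` {..<?n})"
  have "m \<in> (\<lambda>k. depth f r (p ! k)) ` {..<?n}"
    unfolding m_def using n3 by (intro Max_in) (auto simp: lessThan_empty_iff)
  then obtain k where k: "k < ?n" "depth f r (p ! k) = m" by auto
  have mx: "depth f r (p ! l) \<le> depth f r (p ! k)" if "l < ?n" for l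
    unfolding k(2) unfolding m_def using that by (intro Max_ge) auto
  have up: "p ! l = f (p ! k)" if "l < ?n" "{p ! k, p ! l} \<in> parent_edges V r f" for l
    using that(2)
  proof (cases rule: parent_edges_cases)
    case 2
    then show ?thesis using depth_parent[OF f, of "p ! l"] mx[OF that(1)] by simp
  qed
  \<comment> \<open>The cyclic predecessor of \<open>k\<close>, wrapping around at 0.\<close>
  define l where "l = (if k = 0 then ?n - 1 else k - 1)"
  have l: "l < ?n" "Suc l mod ?n = k" using k n3 by (auto simp: l_def)
  have sk: "Suc k mod ?n < ?n" using k(1) by (intro mod_less_divisor) linarith
  have "p ! (Suc k mod ?n) = p ! l"
    using up[OF sk e[OF k(1)]] up[OF l(1)] e[OF l(1)] l(2) by (simp add: insert_commute)
  hence "Suc k mod ?n = l" using dp sk l(1) by (simp add: nth_eq_iff_index_eq)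
  moreover have "Suc k mod ?n \<noteq> l"
    using k n3 by (cases "Suc k = ?n") (auto simp: l_def)
  ultimately show False by simp
qed

text \<open>Induction on depth towards the root. The edge from \<open>i\<close> to
  \<open>f i\<close> could disagree with \<open>g\<close> only if \<open>g (f i) = i\<close>; the
  induction hypothesis at \<open>f i\<close> then gives \<open>f (f i) = i\<close>, which is
  impossible because \<open>f\<close> lowers the depth.\<close>

lemma parent_edges_inj:
  assumes "parent_map V E r f" "parent_map V E r g" "simple_graph V E"
    and "parent_edges V r f = parent_edges V r g"
  shows "f = g"
proof
  have "f i = g i" if "i \<in> V" for i
    using that
  proof (induction "depth f r i" arbitrary: i rule: less_induct)
    case less
    show ?case
    proof (cases "i = r")
      case True
      then show ?thesis using assms(1,2) by (simp add: parent_map_def)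
    next
      case False
      have d: "depth f r i = Suc (depth f r (f i))"
        using depth_parent[OF assms(1) less.prems False] .
      have "{i, f i} \<in> parent_edges V r g"
        using less.prems False assms(4) by (auto simp: parent_edges_def)
      then show ?thesis
      proof (cases rule: parent_edges_cases)
        case 2
        hence "f (f i) = i" using less.hyps[of "f i"] d by simp
        then show ?thesis using depth_parent[OF assms(1), of "f i"] 2 d by simp
      qed simp
    qed
  qed
  then show "f i = g i" for i using assms(1,2) by (cases "i \<in> V") (auto simp: parent_map_def)
qed

text \<open>Each vertex other than \<open>r\<close> is sent to some neighbour strictly closer to
  \<open>r\<close>, where \<open>d\<close> is the graph distance to \<open>r\<close>. Used below
  both for the whole graph and for a given spanning tree.\<close>

lemma parent_map_exists:
  assumes "connected_graph V T" "simple_graph V T" "r \<in> V"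
  shows "\<exists>f. parent_map V T r f"
proof -
  define R where "R = {(x, y). {x, y} \<in> T}"
  define d where "d i = (LEAST k. (i, r) \<in> R ^^ k)" for i
  have reach: "\<exists>k. (i, r) \<in> R ^^ k" if "i \<in> V" for i
    using assms that unfolding connected_graph_def R_def by (blast dest: rtrancl_imp_relpow)
  have dI: "(i, r) \<in> R ^^ d i" if "i \<in> V" for i
    using reach[OF that] unfolding d_def by (rule LeastI_ex)
  have ex: "\<exists>j. {i, j} \<in> T \<and> d j < d i" if i: "i \<in> V" "i \<noteq> r" for i
  proof -
    obtain m where m: "d i = Suc m"
      using dI[OF i(1)] i(2) by (cases "d i") auto
    then obtain j where j: "(i, j) \<in> R" "(j, r) \<in> R ^^ m"
      using dI[OF i(1)] by (metis relpow_Suc_D2)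
    have "d j \<le> m" unfolding d_def using j(2) by (rule Least_le)
    with j m show ?thesis by (auto simp: R_def)
  qed
  define f where "f i = (if i \<in> V - {r} then SOME j. {i, j} \<in> T \<and> d j < d i else i)" for i
  have f: "{i, f i} \<in> T" "d (f i) < d i" if "i \<in> V" "i \<noteq> r" for i
    using someI_ex[OF ex[OF that]] that by (auto simp: f_def)
  have "\<exists>k. (f ^^ k) i = r" if "i \<in> V" for i
    using that
  proof (induction "d i" arbitrary: i rule: less_induct)
    case less
    show ?case
    proof (cases "i = r")
      case True
      then show ?thesis by (intro exI[of _ 0]) simp
    next
      case False
      from f[OF less.prems False] less.hyps simple_graph_edgeD(2)[OF assms(2)]
      obtain k where "(f ^^ k) (f i) = r" by blast
      then show ?thesis by (intro exI[of _ "Suc k"]) (simp add: funpow_swap1)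
    qed
  qed
  with f have "parent_map V T r f" using assms(3) by (auto simp: parent_map_def f_def)
  then show ?thesis by blast
qed

section \<open>Fundamental cycles and the bijection with spanning trees\<close>

lemma rtrancl_distinct_path:
  assumes "(u, v) \<in> {(x, y). {x, y} \<in> T}\<^sup>*"
  obtains p where "p \<noteq> []" "hd p = u" "last p = v" "distinct p"
    "successively (\<lambda>x y. {x, y} \<in> T) p"
proof -
  from assms have "\<exists>p. p \<noteq> [] \<and> hd p = u \<and> last p = v \<and> distinct p \<and>
    successively (\<lambda>x y. {x, y} \<in> T) p"
  proof (induction rule: converse_rtrancl_induct)
    case base
    show ?case by (intro exI[of _ "[v]"]) simp
  next
    case (step y z)
    then obtain p where p: "p \<noteq> []" "hd p = z" "last p = v" "distinct p"
      "successively (\<lambda>x y. {x, y} \<in> T) p" by blast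
    show ?case
    proof (cases "y \<in> set p")
      case True
      \<comment> \<open>If \<open>y\<close> already lies on the path, the part before its occurrence
        is cut off instead of prepending \<open>y\<close>.\<close>
      then obtain xs ys where "p = xs @ y # ys" by (meson split_list)
      with p show ?thesis
        by (intro exI[of _ "y # ys"]) (auto simp: successively_append_iff)
    next
      case False
      with p step.hyps(1) show ?thesis
        by (intro exI[of _ "y # p"]) (auto simp: successively_Cons)
    qed
  qed
  then show ?thesis using that by blast
qed

lemma closed_path_graph_cycle:
  assumes "distinct p" "successively (\<lambda>x y. {x, y} \<in> E) p" "{last p, hd p} \<in> E" "3 \<le> length p"
  shows "graph_cycle E p"
  unfolding graph_cycle_def
proof (intro conjI allI impI)
  fix k assume k: "k < length p"
  have ne: "p \<noteq> []" using k by auto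
  show "{p ! k, next_vertex p k} \<in> E"
  proof (cases "Suc k = length p")
    case True
    hence "p ! k = last p" using ne by (simp add: last_conv_nth flip: True)
    then show ?thesis using assms(3) True ne by (simp add: next_vertex_def hd_conv_nth)
  next
    case False
    then show ?thesis using assms(2) k by (simp add: next_vertex_def successively_conv_nth)
  qed
qed (use assms in auto)

text \<open>The tree path from \<open>u\<close> to \<open>v\<close> is closed up by the edge between
  them. Listing it from \<open>u\<close> to \<open>v\<close> makes that edge the wrap-around pair,
  so all other pairs are tree edges.\<close>

lemma fundamental_cycle:
  assumes f: "parent_map V E r f" and E: "simple_graph V E" "r \<in> V"
    and e: "{u, v} \<in> E" "{u, v} \<notin> parent_edges V r f"
  obtains p where "graph_cycle E p" "hd p = u" "last p = v"
    "successively (\<lambda>x y. {x, y} \<in> parent_edges V r f) p"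
proof -
  let ?T = "parent_edges V r f"
  note uv = simple_graph_edgeD[OF E(1) e(1)]
  have "(u, v) \<in> {(x, y). {x, y} \<in> ?T}\<^sup>*"
    using parent_edges_connected[OF f E] uv by (auto simp: connected_graph_def)
  then obtain p where p: "p \<noteq> []" "hd p = u" "last p = v" "distinct p"
    "successively (\<lambda>x y. {x, y} \<in> ?T) p" by (rule rtrancl_distinct_path)
  \<comment> \<open>One vertex would give \<open>u = v\<close>, and two would make the closing edge
    itself a tree edge.\<close>
  have "3 \<le> length p"
  proof (rule ccontr)
    assume "\<not> 3 \<le> length p"
    then consider "length p = 0" | "length p = 1" | "length p = 2" by linarith
    then show False
      using p e(2) uv(3) by cases (auto simp: length_Suc_conv numeral_2_eq_2)
  qed
  moreover have "successively (\<lambda>x y. {x, y} \<in> E) p"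
    using p(5) by (rule successively_mono) (use parent_edges_subset[OF f] in auto)
  moreover have "{last p, hd p} \<in> E" using e(1) p by (simp add: insert_commute)
  ultimately show ?thesis using that closed_path_graph_cycle p by blast
qed

text \<open>For surjectivity, a parent map is taken inside the tree \<open>T\<close> itself; an edge
  of \<open>T\<close> missed by it would close a fundamental cycle in \<open>T\<close>.\<close>

lemma bij_betw_parent_maps_spanning_trees:
  assumes "simple_graph V E" "r \<in> V"
  shows "bij_betw (parent_edges V r) {f. parent_map V E r f} (spanning_trees V E)"
  unfolding bij_betw_def
proof (intro conjI equalityI subsetI)
  show "inj_on (parent_edges V r) {f. parent_map V E r f}"
    by (intro inj_onI parent_edges_inj[OF _ _ assms(1)]) simp_all
next
  fix T assume "T \<in> parent_edges V r ` {f. parent_map V E r f}"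
  then obtain f where f: "parent_map V E r f" "T = parent_edges V r f" by blast
  show "T \<in> spanning_trees V E"
    using parent_edges_subset[OF f(1)] parent_edges_connected[OF f(1) assms]
      parent_edges_acyclic[OF f(1)] simple_graph_subset[OF assms(1)]
    by (auto simp: spanning_trees_def tree_graph_def f(2))
next
  fix T assume "T \<in> spanning_trees V E"
  hence T: "T \<subseteq> E" "simple_graph V T" "connected_graph V T" "\<nexists>p. graph_cycle T p"
    by (auto simp: spanning_trees_def tree_graph_def)
  obtain f where f: "parent_map V T r f" using parent_map_exists[OF T(3,2) assms(2)] by blast
  have "e \<in> parent_edges V r f" if eT: "e \<in> T" for e
  proof -
    have "card e = 2" using eT T(2) by (simp add: simple_graph_def)
    then obtain u v where e: "e = {u, v}" by (auto simp: card_2_iff)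
    show ?thesis
    proof (rule ccontr)
      assume "e \<notin> parent_edges V r f"
      with eT have "{u, v} \<in> T" "{u, v} \<notin> parent_edges V r f" by (simp_all add: e)
      then show False
        by (rule fundamental_cycle[OF f T(2) assms(2)]) (use T(4) in simp)
    qed
  qed
  hence "T = parent_edges V r f" using parent_edges_subset[OF f] by blast
  then show "T \<in> parent_edges V r ` {f. parent_map V E r f}"
    using parent_map_mono[OF f T(1)] by simp
qed

section \<open>Potentials of balanced gain graphs\<close>

lemma potential_exists:
  fixes g :: "'a \<Rightarrow> 'a \<Rightarrow> complex"
  assumes E: "simple_graph V E" "connected_graph V E"
    and inv: "\<And>u v. {u, v} \<in> E \<Longrightarrow> g u v * g v u = 1"
    and unit: "\<And>u v. {u, v} \<in> E \<Longrightarrow> cmod (g u v) = 1"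
    and cyc: "\<And>p. graph_cycle E p \<Longrightarrow> (\<Prod>k<length p. g (p ! k) (next_vertex p k)) = 1"
  shows "\<exists>s. (\<forall>v\<in>V. cmod (s v) = 1) \<and> (\<forall>u v. {u, v} \<in> E \<longrightarrow> s u = g u v * s v)"
proof -
  obtain r where r: "r \<in> V" using E(2) by (auto simp: connected_graph_def)
  obtain f where f: "parent_map V E r f" using parent_map_exists[OF E(2,1) r] by blast
  \<comment> \<open>The product of the gains along the tree path from \<open>i\<close> to the
    root.\<close>
  define s where "s i = (\<Prod>k<depth f r i. g ((f ^^ k) i) ((f ^^ Suc k) i))" for i
  have step: "s i = g i (f i) * s (f i)" if "i \<in> V" "i \<noteq> r" for i
    unfolding s_def depth_parent[OF f that] prod.lessThan_Suc_shift
    by (simp add: funpow_swap1)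
  have tree: "s x = g x y * s y" if "{x, y} \<in> parent_edges V r f" for x y
    using that
  proof (cases rule: parent_edges_cases)
    case 1
    then show ?thesis using step by simp
  next
    case 2
    have "g x y * g y x = 1" using inv that parent_edges_subset[OF f] by auto
    then show ?thesis using step[OF 2(1,2)] 2(3) by (simp flip: mult.assoc)
  qed
  have norm: "cmod (s i) = 1" if "i \<in> V" for i
    using that
  proof (induction "depth f r i" arbitrary: i rule: less_induct)
    case less
    show ?case
    proof (cases "i = r")
      case True
      then show ?thesis by (simp add: s_def depth_root)
    next
      case False
      then show ?thesis
        using less depth_parent[OF f less.prems False] parent_map_closed[OF f E(1) less.prems]
          step[OF less.prems False] unit[of i "f i"] f
        by (simp add: norm_mult parent_map_def)
    qed
  qed
  have "s u = g u v * s v" if e: "{u, v} \<in> E" for u v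
  proof (cases "{u, v} \<in> parent_edges V r f")
    case False
    obtain p where p: "graph_cycle E p" "hd p = u" "last p = v"
      "successively (\<lambda>x y. {x, y} \<in> parent_edges V r f) p"
      using fundamental_cycle[OF f E(1) r e False] .
    have n3: "3 \<le> length p" using p(1) by (simp add: graph_cycle_def)
    hence ne: "p \<noteq> []" by auto
    define m where "m = length p - 1"
    have lp: "length p = Suc m" using n3 by (simp add: m_def)
    \<comment> \<open>The tree relation telescopes along the path part of the fundamental
      cycle.\<close>
    have tel: "s (p ! 0) = (\<Prod>k<l. g (p ! k) (p ! Suc k)) * s (p ! l)" if "l < length p" for l
      using that
    proof (induction l)
      case (Suc l)
      have "s (p ! l) = g (p ! l) (p ! Suc l) * s (p ! Suc l)"
        using tree p(4) Suc.prems by (simp add: successively_conv_nth)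
      then show ?case using Suc by simp
    qed simp
    have ends: "p ! 0 = u" "p ! m = v"
      using p(2,3) ne by (simp_all add: hd_conv_nth last_conv_nth m_def)
    have "(\<Prod>k<m. g (p ! k) (next_vertex p k)) = (\<Prod>k<m. g (p ! k) (p ! Suc k))"
      by (intro prod.cong) (auto simp: next_vertex_def lp)
    \<comment> \<open>The last factor of the cycle product, at index \<open>m\<close>, belongs to
      the wrap-around edge from \<open>v\<close> back to \<open>u\<close>.\<close>
    hence one: "(\<Prod>k<m. g (p ! k) (p ! Suc k)) * g v u = 1"
      using cyc[OF p(1)] ends by (simp add: lp next_vertex_def)
    \<comment> \<open>The factor \<open>g u v * g v u\<close>, equal to 1, is inserted to complete
      the cycle product.\<close>
    have "s u = (\<Prod>k<m. g (p ! k) (p ! Suc k)) * s v * (g u v * g v u)"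
      using tel[of m] ends lp inv[OF e] by simp
    also have "\<dots> = ((\<Prod>k<m. g (p ! k) (p ! Suc k)) * g v u) * (g u v * s v)"
      by (simp only: ac_simps)
    finally show ?thesis using one by simp
  qed (rule tree)
  with norm show ?thesis by blast
qed

section \<open>Cofactors and kernel vectors\<close>

text \<open>Cofactors along row \<open>i\<close> do not see row \<open>i\<close>, so that row may be
  replaced before a Laplace expansion.\<close>

lemma cofactor_cong_off_row:
  assumes "A \<in> carrier_mat n n" "B \<in> carrier_mat n n" "i < n" "j < n"
    and "\<And>a b. a < n \<Longrightarrow> b < n \<Longrightarrow> a \<noteq> i \<Longrightarrow> A $$ (a, b) = B $$ (a, b)"
  shows "cofactor A i j = cofactor B i j"
proof -
  have "mat_delete A i j = mat_delete B i j"
    by (rule eq_matI) (use assms in \<open>auto simp: mat_delete_def\<close>)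
  then show ?thesis by (simp add: cofactor_def)
qed

lemma det_eq_0_kernel:
  fixes A :: "'a :: idom mat"
  assumes "A \<in> carrier_mat n n" "j < n" "s j \<noteq> 0"
    and "\<And>a. a < n \<Longrightarrow> (\<Sum>b<n. A $$ (a, b) * s b) = 0"
  shows "det A = 0"
proof -
  have "vec n s \<noteq> 0\<^sub>v n"
    using assms(2,3) by (metis index_vec index_zero_vec(1))
  moreover have "A *\<^sub>v vec n s = 0\<^sub>v n"
    using assms(1,4) by (intro eq_vecI) (auto simp: scalar_prod_def lessThan_atLeast0)
  ultimately show ?thesis
    using det_0_iff_vec_prod_zero[OF assms(1)] vec_carrier[of n s] by blast
qed

text \<open>Replace row \<open>i\<close> by \<open>w\<close>, which has \<open>s k\<close> at
  \<open>j\<close> and \<open>- s j\<close> at \<open>k\<close> and so annihilates \<open>s\<close>.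
  The new matrix still kills \<open>s\<close>, hence is singular when \<open>s j\<close> or
  \<open>s k\<close> is nonzero; expanding its determinant along row \<open>i\<close> gives the
  identity.\<close>

lemma cofactor_kernel:
  fixes A :: "'a :: idom mat"
  assumes A: "A \<in> carrier_mat n n" and ijk: "i < n" "j < n" "k < n"
    and ker: "\<And>a. a < n \<Longrightarrow> (\<Sum>b<n. A $$ (a, b) * s b) = 0"
  shows "s k * cofactor A i j = s j * cofactor A i k"
proof (cases "s j = 0 \<and> s k = 0")
  case False
  define w where "w b = (if b = j then s k else 0) - (if b = k then s j else 0)" for b
  define M where "M = mat n n (\<lambda>(a, b). if a = i then w b else A $$ (a, b))"
  have M: "M \<in> carrier_mat n n" by (simp add: M_def)
  have "(\<Sum>b<n. M $$ (a, b) * s b) = 0" if "a < n" for a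
  proof (cases "a = i")
    case True
    have "(\<Sum>b<n. M $$ (a, b) * s b) =
        (\<Sum>b<n. (if b = j then s k * s b else 0) - (if b = k then s j * s b else 0))"
      using that True by (intro sum.cong) (auto simp: M_def w_def)
    also have "\<dots> = 0" using ijk by (simp add: sum_subtractf)
    finally show ?thesis .
  next
    case False
    then show ?thesis using ker[OF that] that by (simp add: M_def)
  qed
  moreover obtain b where "b < n" "s b \<noteq> 0" using False ijk by blast
  ultimately have "0 = det M" using det_eq_0_kernel[OF M, of b s] by simp
  also have "\<dots> = (\<Sum>b<n. w b * cofactor A i b)"
    unfolding laplace_expansion_row[OF M ijk(1)]
    using ijk(1) by (intro sum.cong arg_cong2[of _ _ _ _ "(*)"] cofactor_cong_off_row[OF M A])
      (auto simp: M_def)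
  also have "\<dots> = (\<Sum>b<n. (if b = j then s k * cofactor A i b else 0) -
      (if b = k then s j * cofactor A i b else 0))"
    by (intro sum.cong) (auto simp: w_def)
  also have "\<dots> = s k * cofactor A i j - s j * cofactor A i k"
    using ijk by (simp add: sum_subtractf)
  finally show ?thesis by simp
qed simp

section \<open>Expansion of a principal cofactor over parent maps\<close>

text \<open>\<open>M\<close> is unitriangular once vertices are sorted by depth. Instead of
  reordering, the Leibniz formula is used: a nonzero term has \<open>p a\<close> equal to
  \<open>a\<close> or \<open>f a\<close>, and if \<open>p\<close> already fixes \<open>f a\<close>,
  then injectivity rules out \<open>p a = f a\<close> unless \<open>f a = a\<close>. By induction on
  depth only the identity survives.\<close>

lemma det_parent_map:
  fixes N :: "nat \<Rightarrow> nat \<Rightarrow> 'a :: comm_ring_1"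
  assumes f: "parent_map {0..<n} E r f"
    and M: "M = mat n n (\<lambda>(a, b). (if b = a then 1 else 0) +
      (if a \<noteq> r \<and> b = f a then N a b else 0))"
    and E: "simple_graph {0..<n} E"
  shows "det M = 1"
proof -
  have Mc: "M \<in> carrier_mat n n" by (simp add: M)
  have zero: "(\<Prod>a = 0..<n. M $$ (a, p a)) = 0" if p: "p permutes {0..<n}" "p \<noteq> id" for p
  proof (rule ccontr)
    assume nz: "(\<Prod>a = 0..<n. M $$ (a, p a)) \<noteq> 0"
    have step: "p a = a \<or> (a \<noteq> r \<and> p a = f a)" if "a < n" for a
    proof (rule ccontr)
      assume "\<not> ?thesis"
      moreover have "p a < n" using permutes_in_image[OF p(1), of a] that by simp
      ultimately have "M $$ (a, p a) = 0" using that by (auto simp: M)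
      then have "(\<Prod>a = 0..<n. M $$ (a, p a)) = 0" using that by (intro prod_zero) auto
      with nz show False by simp
    qed
    have "p a = a" if "a < n" for a
      using that
    proof (induction "depth f r a" arbitrary: a rule: less_induct)
      case less
      show ?case
      proof (rule ccontr)
        assume ne: "p a \<noteq> a"
        hence a: "a \<noteq> r" "p a = f a" using step[OF less.prems] by auto
        have "depth f r (f a) < depth f r a" using depth_parent[OF f] a less.prems by simp
        moreover have "f a < n" using parent_map_closed[OF f E] less.prems by simp
        ultimately have "p (f a) = f a" using less.hyps by blast
        hence "p (f a) = p a" using a by simp
        hence "f a = a" using permutes_inj[OF p(1)] by (simp add: inj_eq)
        with ne a show False by simp
      qed
    qed
    hence "p a = a" for a using permutes_not_in[OF p(1), of a] by (cases "a < n") auto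
    with p(2) show False by auto
  qed
  have "det M = (\<Sum>p\<in>{p. p permutes {0..<n}}. signof p * (\<Prod>a = 0..<n. M $$ (a, p a)))"
    by (rule det_def'[OF Mc])
  also have "\<dots> = (\<Sum>p\<in>{id}. signof p * (\<Prod>a = 0..<n. M $$ (a, p a)))"
    by (rule sum.mono_neutral_right) (auto simp: zero finite_permutations)
  also have "\<dots> = (\<Prod>a = 0..<n. M $$ (a, a))" by simp
  also have "\<dots> = 1"
  proof (intro prod.neutral ballI)
    fix a assume a: "a \<in> {0..<n}"
    have "f a \<noteq> a" if "a \<noteq> r"
      using depth_parent[OF f a that] by auto
    then show "M $$ (a, a) = 1" using a by (auto simp: M)
  qed
  finally show ?thesis .
qed

lemma degree_graph_neighbours:
  assumes "simple_graph V E"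
  shows "degree_graph E v = card {w \<in> V. {v, w} \<in> E}"
proof -
  have "bij_betw (\<lambda>w. {v, w}) {w \<in> V. {v, w} \<in> E} {e \<in> E. v \<in> e}"
    unfolding bij_betw_def
  proof (intro conjI equalityI subsetI)
    show "inj_on (\<lambda>w. {v, w}) {w \<in> V. {v, w} \<in> E}"
      by (auto simp: inj_on_def doubleton_eq_iff)
  next
    fix e assume e: "e \<in> {e \<in> E. v \<in> e}"
    then obtain x y where xy: "e = {x, y}" using assms by (auto simp: simple_graph_def card_2_iff)
    then have "\<exists>w. e = {v, w}" using e by auto
    then obtain w where "e = {v, w}" ..
    with e simple_graph_edgeD(2)[OF assms]
    show "e \<in> (\<lambda>w. {v, w}) ` {w \<in> V. {v, w} \<in> E}" by auto
  qed auto
  then show ?thesis by (simp add: degree_graph_def bij_betw_same_card)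
qed

lemma principal_cofactor_balanced:
  fixes N :: "nat \<Rightarrow> nat \<Rightarrow> 'a :: idom"
  assumes E: "simple_graph {0..<n} E" and r: "r < n"
    and N0: "\<And>i j. {i, j} \<notin> E \<Longrightarrow> N i j = 0"
    and s0: "\<And>i. i < n \<Longrightarrow> s i \<noteq> 0"
    and s: "\<And>i j. {i, j} \<in> E \<Longrightarrow> s i + N i j * s j = 0"
    and Q: "Q = mat n n (\<lambda>(i, j). (if i = j then of_nat (degree_graph E i) else 0) + N i j)"
  shows "cofactor Q r r = of_nat (card (spanning_trees {0..<n} E))"
proof -
  \<comment> \<open>The summand of row \<open>i\<close> for the choice \<open>j\<close>.
    Non-neighbours get the zero vector, so \<open>j\<close> may range over all indices; in row
    \<open>r\<close> only \<open>j = r\<close> is nonzero, which forces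
    \<open>f r = r\<close>.\<close>
  define a where "a i j =
    (if i = r then if j = r then unit_vec n r else 0\<^sub>v n
     else if {i, j} \<in> E then vec n (\<lambda>k. (if k = i then 1 else 0) + (if k = j then N i j else 0))
     else 0\<^sub>v n)" for i j
  have ac: "a i j \<in> carrier_vec n" for i j by (simp add: a_def)
  define B where "B = mat\<^sub>r n n (\<lambda>i. finsum_vec TYPE('a) n (a i) {0..<n})"
  have Bc: "B \<in> carrier_mat n n" and Qc: "Q \<in> carrier_mat n n" by (simp_all add: B_def Q)
  have Bij: "B $$ (i, k) = (\<Sum>j<n. a i j $ k)" if "i < n" "k < n" for i k
    using that ac by (simp add: B_def index_finsum_vec lessThan_atLeast0)
  have Br: "B $$ (r, k) = (if k = r then 1 else 0)" if "k < n" for k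
  proof -
    have "B $$ (r, k) = (\<Sum>j<n. if j = r then if k = r then 1 else 0 else 0)"
      unfolding Bij[OF r that] using that r by (intro sum.cong) (auto simp: a_def)
    then show ?thesis using r by simp
  qed
  have BQ: "B $$ (i, k) = Q $$ (i, k)" if ik: "i < n" "k < n" "i \<noteq> r" for i k
  proof -
    have "B $$ (i, k) = (\<Sum>j<n. (if {i, j} \<in> E then if k = i then 1 else 0 else 0) +
        (if j = k then N i j else 0))"
      unfolding Bij[OF ik(1,2)] using ik N0 by (intro sum.cong) (auto simp: a_def)
    also have "\<dots> = (\<Sum>j<n. if {i, j} \<in> E then if k = i then 1 else 0 else 0) + N i k"
      using ik by (simp add: sum.distrib)
    \<comment> \<open>Each neighbour contributes one unit vector at \<open>i\<close>, which adds up
      to the degree.\<close>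
    also have "(\<Sum>j<n. if {i, j} \<in> E then if k = i then 1 else 0 else (0 :: 'a)) =
        (if i = k then of_nat (degree_graph E i) else 0)"
      by (simp add: degree_graph_neighbours[OF E] sum.If_cases Int_def conj_commute)
    finally show ?thesis using ik by (simp add: Q)
  qed
  \<comment> \<open>\<open>B\<close> is \<open>Q\<close> with row \<open>r\<close> replaced by the
    unit vector, so the Laplace expansion of \<open>det B\<close> along row \<open>r\<close> is this
    single cofactor.\<close>
  have "cofactor Q r r = cofactor B r r"
    using BQ by (intro cofactor_cong_off_row[OF Qc Bc r r]) simp
  also have "\<dots> = (\<Sum>k<n. if k = r then cofactor B r k else 0)" using r by simp
  also have "\<dots> = det B"
    unfolding laplace_expansion_row[OF Bc r] using Br by (intro sum.cong) auto
  also have "\<dots> = (\<Sum>f\<in>{f. (\<forall>i\<in>{0..<n}. f i \<in> {0..<n}) \<and> (\<forall>i. i \<notin> {0..<n} \<longrightarrow> f i = i)}.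
      det (mat\<^sub>r n n (\<lambda>i. a i (f i))))" (is "_ = sum ?D ?F")
    unfolding B_def by (rule det_linear_rows_sum) (use ac in auto)
  also have "\<dots> = (\<Sum>f\<in>?F. if parent_map {0..<n} E r f then 1 else 0)"
  proof (rule sum.cong[OF refl])
    fix f assume fF: "f \<in> ?F"
    hence fn: "f i < n" if "i < n" for i using that by auto
    let ?M = "mat\<^sub>r n n (\<lambda>i. a i (f i))"
    show "?D f = (if parent_map {0..<n} E r f then 1 else 0)"
    proof (cases "parent_map {0..<n} E r f")
      case True
      hence "?M = mat n n (\<lambda>(a, b). (if b = a then 1 else 0) +
          (if a \<noteq> r \<and> b = f a then N a b else 0))"
        by (intro eq_matI) (auto simp: a_def parent_map_def)
      from det_parent_map[OF True this E] show ?thesis using True by simp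
    next
      case False
      have "?D f = 0"
      proof (cases "f r = r \<and> (\<forall>i<n. i \<noteq> r \<longrightarrow> {i, f i} \<in> E)")
        case True
        \<comment> \<open>The potential \<open>s\<close>, restricted to the vertices whose \<open>f\<close>-orbit misses the root,
          is a kernel vector.\<close>
        define reach where "reach i \<longleftrightarrow> (\<exists>k. (f ^^ k) i = r)" for i
        define x where "x i = (if reach i then 0 else s i)" for i
        obtain j where j: "j < n" "\<not> reach j"
          using False True fF by (auto simp: parent_map_def reach_def)
        have rr: "reach r" unfolding reach_def by (rule exI[of _ 0]) simp
        \<comment> \<open>Away from the root, \<open>i\<close> and \<open>f i\<close> both reach
          \<open>r\<close> or both miss it, so the row equation for \<open>x\<close> is either
          trivial or the one for \<open>s\<close>.\<close>
        have reach_step: "reach (f i) \<longleftrightarrow> reach i" if "i \<noteq> r" for i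
        proof
          assume "reach (f i)"
          then obtain k where "(f ^^ k) (f i) = r" by (auto simp: reach_def)
          then show "reach i" unfolding reach_def
            by (intro exI[of _ "Suc k"]) (simp add: funpow_swap1)
        next
          assume "reach i"
          then obtain k where k: "(f ^^ k) i = r" by (auto simp: reach_def)
          with that obtain l where "k = Suc l" by (cases k) auto
          with k show "reach (f i)" unfolding reach_def
            by (intro exI[of _ l]) (simp add: funpow_swap1)
        qed
        have "(\<Sum>b<n. ?M $$ (i, b) * x b) = 0" if i: "i < n" for i
        proof (cases "i = r")
          case True
          have "(\<Sum>b<n. ?M $$ (i, b) * x b) = 0"
            using i True rr \<open>f r = r \<and> _\<close> by (intro sum.neutral) (auto simp: a_def x_def)
          then show ?thesis .
        next
          case ir: False
          have e: "{i, f i} \<in> E" using True i ir by blast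
          have "(\<Sum>b<n. ?M $$ (i, b) * x b) =
              (\<Sum>b<n. (if b = i then x b else 0) + (if b = f i then N i b * x b else 0))"
            using i ir e by (intro sum.cong) (auto simp: a_def algebra_simps)
          also have "\<dots> = x i + N i (f i) * x (f i)"
            using i fn[OF i] by (simp add: sum.distrib)
          also have "\<dots> = 0" using s[OF e] reach_step[OF ir] by (simp add: x_def)
          finally show ?thesis .
        qed
        then show ?thesis
          using j s0 by (intro det_eq_0_kernel[of ?M n j x]) (auto simp: x_def)
      next
        case False
        \<comment> \<open>Either \<open>f\<close> moves \<open>r\<close> or it picks a
          non-neighbour; both choices select a zero row.\<close>
        then obtain i where i: "i < n" "a i (f i) = 0\<^sub>v n"
          using r by (auto simp: a_def)
        have "det ?M = (\<Sum>j<n. ?M $$ (i, j) * cofactor ?M i j)"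
          by (rule laplace_expansion_row[OF _ i(1)]) simp
        also have "\<dots> = 0" using i by (intro sum.neutral) auto
        finally show ?thesis .
      qed
      with False show ?thesis by simp
    qed
  qed
  also have "\<dots> = of_nat (card {f. parent_map {0..<n} E r f})"
  proof -
    have "finite ?F" by (rule finite_bounded_functions) auto
    moreover have "{f \<in> ?F. parent_map {0..<n} E r f} = {f. parent_map {0..<n} E r f}"
      using parent_map_closed[OF _ E] by (auto simp: parent_map_def)
    ultimately show ?thesis by (simp add: sum.If_cases Int_def)
  qed
  also have "card {f. parent_map {0..<n} E r f} = card (spanning_trees {0..<n} E)"
    using bij_betw_parent_maps_spanning_trees[OF E, of r] r by (simp add: bij_betw_same_card)
  finally show ?thesis .
qed

section \<open>Sixth roots of unity and balance of cycles\<close>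

lemma omega_square: "omega ^ 2 = omega - 1"
  by (simp add: omega_def complex_eq_iff power2_eq_square)

lemma omega_cnj: "cnj omega = - (omega ^ 2)"
  unfolding omega_square by (simp add: omega_def complex_eq_iff)

lemma omega_cube: "omega ^ 3 = - 1"
proof -
  have "omega ^ 3 = omega * omega ^ 2" by (simp add: power3_eq_cube power2_eq_square)
  also have "\<dots> = omega ^ 2 - omega"
    \<comment> \<open>Rewriting only the product \<open>omega * omega ^ 2\<close> leaves the
      \<open>omega ^ 2\<close> on the right intact.\<close>
    unfolding omega_square[THEN arg_cong[of _ _ "\<lambda>x. omega * x"]]
    by (simp add: right_diff_distrib power2_eq_square)
  finally show ?thesis by (simp add: omega_square)
qed

lemma omega_mult_cnj: "omega * cnj omega = 1"
proof -
  have "omega * cnj omega = - (omega ^ 3)"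
    by (simp add: omega_cnj power3_eq_cube power2_eq_square)
  then show ?thesis by (simp add: omega_cube)
qed

text \<open>The entries of \<open>herm_adj2\<close> as a function on vertices of any type; the gains
  in the sense of \<open>potential_exists\<close> are their negatives.\<close>

definition gain :: "'a set set \<Rightarrow> ('a \<times> 'a) set \<Rightarrow> 'a \<Rightarrow> 'a \<Rightarrow> complex" where
  "gain E A u v = (if undirected_edge E A u v then 1 else if (u, v) \<in> A then omega
     else if (v, u) \<in> A then cnj omega else 0)"

text \<open>With \<open>a\<close> forward, \<open>b\<close> backward and \<open>c\<close> undirected
  edges the product is \<open>(- omega) ^ a * (omega ^ 2) ^ b * (- 1) ^ c\<close>, since
  \<open>- cnj omega = omega ^ 2\<close>. If \<open>a + 2 * b = 3 * m\<close>, then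
  \<open>omega ^ 3 = - 1\<close> leaves the sign with exponent \<open>a + m + c\<close>.\<close>

lemma gain_cycle:
  assumes A: "mixed_graph V E A" and p: "graph_cycle E p" and psi: "in_Psi4 E A p"
  shows "(\<Prod>k<length p. - gain E A (p ! k) (next_vertex p k)) = 1"
proof -
  define F where "F = {k. k < length p \<and> (p ! k, next_vertex p k) \<in> A}"
  define B where "B = {k. k < length p \<and> (next_vertex p k, p ! k) \<in> A}"
  define U where "U = {k. k < length p \<and> undirected_edge E A (p ! k) (next_vertex p k)}"
  have asym: "(v, u) \<notin> A" if "(u, v) \<in> A" for u v using A that by (auto simp: mixed_graph_def)
  have fin: "finite F" "finite B" "finite U" by (simp_all add: F_def B_def U_def)
  have disj: "F \<inter> B = {}" "(F \<union> B) \<inter> U = {}"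
    using asym by (auto simp: F_def B_def U_def undirected_edge_def)
  have un: "{..<length p} = (F \<union> B) \<union> U"
    using p by (auto simp: F_def B_def U_def undirected_edge_def graph_cycle_def)
  let ?g = "\<lambda>k. - gain E A (p ! k) (next_vertex p k)"
  have "prod ?g F = (\<Prod>k\<in>F. - omega)"
    by (intro prod.cong) (auto simp: F_def gain_def undirected_edge_def)
  moreover have "prod ?g B = (\<Prod>k\<in>B. omega ^ 2)"
    using asym by (intro prod.cong) (auto simp: B_def gain_def undirected_edge_def omega_cnj)
  moreover have "prod ?g U = (\<Prod>k\<in>U. - 1)"
    by (intro prod.cong) (auto simp: U_def gain_def)
  ultimately have prod: "prod ?g {..<length p} = (- omega) ^ card F * (omega ^ 2) ^ card B * (- 1) ^ card U"
    unfolding un using fin disj by (simp add: prod.union_disjoint)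
  have cyc: "even (card U)" "(int (card F) - int (card B)) mod 6 \<in> {0, 3}"
    using psi by (simp_all add: in_Psi4_def F_def B_def U_def cycle_forward_def
        cycle_backward_def cycle_undirected_def)
  \<comment> \<open>The residues 0 and 3 modulo 6 say that 3 divides \<open>a - b\<close>, and
    \<open>a + 2 * b\<close> differs from this by \<open>3 * b\<close>.\<close>
  from cyc(2) have "3 dvd card F + 2 * card B" by simp presburger
  then obtain m where m: "card F + 2 * card B = 3 * m" by (rule dvdE)
  have "(- omega) ^ card F * (omega ^ 2) ^ card B = (- 1) ^ card F * omega ^ (card F + 2 * card B)"
    by (simp add: power_minus[of omega] power_add power_mult)
  also have "\<dots> = (- 1) ^ (card F + m)"
    unfolding m power_mult omega_cube by (simp add: power_add)
  also have "\<dots> = 1"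
  proof -
    \<comment> \<open>Modulo 2, \<open>3 * m\<close> is \<open>m\<close> and
      \<open>card F + 2 * card B\<close> is \<open>card F\<close>.\<close>
    have "even (card F + m)" using m by presburger
    then show ?thesis by simp
  qed
  finally show ?thesis unfolding prod using cyc(1) by simp
qed

lemma quasi_laplacian_potential:
  assumes A: "mixed_graph V E A" and "connected_graph V E"
    and "\<And>p. graph_cycle E p \<Longrightarrow> in_Psi4 E A p"
  obtains s where "\<And>v. v \<in> V \<Longrightarrow> cmod (s v) = 1"
    "\<And>u v. {u, v} \<in> E \<Longrightarrow> s u + gain E A u v * s v = 0"
proof -
  have asym: "(v, u) \<notin> A" if "(u, v) \<in> A" for u v using A that by (auto simp: mixed_graph_def)
  have E: "simple_graph V E" using A by (simp add: mixed_graph_def)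
  have norm: "cmod omega = 1"
    by (simp add: omega_def cmod_def power2_eq_square)
  have "- gain E A u v * - gain E A v u = 1" if "{u, v} \<in> E" for u v
    using that asym omega_mult_cnj
    by (auto simp: gain_def undirected_edge_def insert_commute mult.commute)
  moreover have "cmod (- gain E A u v) = 1" if "{u, v} \<in> E" for u v
    using that norm by (auto simp: gain_def undirected_edge_def)
  moreover have "(\<Prod>k<length p. - gain E A (p ! k) (next_vertex p k)) = 1" if "graph_cycle E p" for p
    using gain_cycle[OF A that assms(3)[OF that]] .
  ultimately obtain s where "\<forall>v\<in>V. cmod (s v) = 1"
    "\<forall>u v. {u, v} \<in> E \<longrightarrow> s u = - gain E A u v * s v"
    using potential_exists[OF E assms(2), of "\<lambda>u v. - gain E A u v"] by blast
  then show ?thesis by (simp add: that[of s])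
qed

theorem theorem3p8:
  fixes n :: nat and E :: "nat set set" and A :: "(nat \<times> nat) set"
  assumes "mixed_graph {0..<n} E A"
    and "connected_graph {0..<n} E"
    and "\<And>p. graph_cycle E p \<Longrightarrow> in_Psi4 E A p"
  shows "\<forall>i<n. \<forall>j<n. cmod (cofactor (herm_quasi_laplacian2 n E A) i j)
           = real (card (spanning_trees {0..<n} E))"
proof (intro allI impI)
  fix i j assume ij: "i < n" "j < n"
  let ?Q = "herm_quasi_laplacian2 n E A"
  obtain s where s: "\<And>v. v \<in> {0..<n} \<Longrightarrow> cmod (s v) = 1"
    "\<And>u v. {u, v} \<in> E \<Longrightarrow> s u + gain E A u v * s v = 0"
    by (rule quasi_laplacian_potential[OF assms]) (assumption | rule that)+
  have E: "simple_graph {0..<n} E" using assms(1) by (simp add: mixed_graph_def)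
  have N0: "gain E A u v = 0" if "{u, v} \<notin> E" for u v
    using that assms(1) by (auto simp: gain_def undirected_edge_def mixed_graph_def insert_commute)
  have Q: "?Q = mat n n (\<lambda>(i, j). (if i = j then of_nat (degree_graph E i) else 0) + gain E A i j)"
    by (rule eq_matI)
      (auto simp: herm_quasi_laplacian2_def degree_mat_def herm_adj2_def gain_def)
  have s0: "s v \<noteq> 0" if "v < n" for v
    using s(1)[of v] that by auto
  have ii: "cofactor ?Q i i = of_nat (card (spanning_trees {0..<n} E))"
    by (rule principal_cofactor_balanced[OF E ij(1) N0 s0 s(2) Q])
  have "(\<Sum>b<n. ?Q $$ (a, b) * s b) = 0" if a: "a < n" for a
  proof -
    have "(\<Sum>b<n. ?Q $$ (a, b) * s b) =
        (\<Sum>b<n. (if b = a then of_nat (degree_graph E a) * s b else 0) + gain E A a b * s b)"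
      using a by (intro sum.cong) (auto simp: Q algebra_simps)
    also have "\<dots> = of_nat (degree_graph E a) * s a + (\<Sum>b<n. gain E A a b * s b)"
      using a by (simp add: sum.distrib)
    \<comment> \<open>Each neighbour of \<open>a\<close> contributes \<open>- s a\<close>, so the
      sum cancels the degree term.\<close>
    also have "(\<Sum>b<n. gain E A a b * s b) = (\<Sum>b<n. if {a, b} \<in> E then - s a else 0)"
      using N0 s(2)[THEN add_eq_0_iff[THEN iffD1]] by (intro sum.cong) auto
    also have "\<dots> = - of_nat (degree_graph E a) * s a"
      by (simp add: degree_graph_neighbours[OF E] sum.If_cases Int_def conj_commute)
    finally show ?thesis by simp
  qed
  \<comment> \<open>The kernel vector moves column \<open>j\<close> to the diagonal within row
    \<open>i\<close>; since \<open>s\<close> is unimodular, absolute values agree.\<close>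
  hence "s i * cofactor ?Q i j = s j * cofactor ?Q i i"
    by (intro cofactor_kernel[of ?Q n]) (use ij in \<open>auto simp: Q\<close>)
  hence "cmod (s i) * cmod (cofactor ?Q i j) = cmod (s j) * cmod (cofactor ?Q i i)"
    by (metis norm_mult)
  then show "cmod (cofactor ?Q i j) = real (card (spanning_trees {0..<n} E))"
    using ij s(1) ii by simp
qed

end
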